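(* For every positive integer $k$, $$\lim_{N \to \infty}\frac{\#\{0 \le n \le N : p(n,k) \text{ is odd}\}}{N} \ge \frac{2}{k(k+1)}.$$
   Context: For a nonnegative integer $n$ and a positive integer $k$, $p(n,k)$ denotes the number of partitions of $n$ into parts each less than or equal to $k$ (so $p(0,k)=1$); equivalently, $\sum_{n\ge 0} p(n,k)q^n = \prod_{i=1}^{k} \frac{1}{1-q^i}$. *)

theory Defs
  imports Complex_Main "HOL-Library.Multiset"
begin

definition partitions_le :: "nat \<Rightarrow> nat \<Rightarrow> nat multiset set" where
  "partitions_le n k = {M. sum_mset M = n \<and> set_mset M \<subseteq> {1..k}}"

definition p :: "nat \<Rightarrow> nat \<Rightarrow> nat" where
  "p n k = card (partitions_le n k)"

lemma finite_partitions_le: "finite (partitions_le n k)"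
proof -
  have size_le: "size M \<le> sum_mset M" if "set_mset M \<subseteq> {1..k}" for M :: "nat multiset"
    using that
  proof (induction M)
    case (add x M)
    then have "1 \<le> x" "size M \<le> sum_mset M"
      by simp_all
    then show ?case
      by simp
  qed simp
  have "partitions_le n k \<subseteq> mset ` {xs. set xs \<subseteq> {1..k} \<and> length xs \<le> n}"
  proof
    fix M assume M: "M \<in> partitions_le n k"
    obtain xs where xs: "M = mset xs"
      by (metis ex_mset)
    have "set xs \<subseteq> {1..k}" "length xs \<le> n"
      using M size_le[of M] by (simp_all add: partitions_le_def xs)
    then show "M \<in> mset ` {xs. set xs \<subseteq> {1..k} \<and> length xs \<le> n}"
      using xs by blast
  qed
  moreover have "finite {xs. set xs \<subseteq> {1..k} \<and> length xs \<le> n}"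
    by (rule finite_lists_length_le) simp
  ultimately show ?thesis
    by (blast intro: finite_subset)
qed

lemma p_0: "p 0 k = 1"
proof -
  have "partitions_le 0 k = {{#}}"
  proof (intro equalityI subsetI)
    fix M assume "M \<in> partitions_le 0 k"
    then have "x \<notin># M" for x
      by (auto simp: partitions_le_def)
    then show "M \<in> {{#}}"
      by (simp add: multiset_eq_iff not_in_iff)
  qed (simp add: partitions_le_def)
  then show ?thesis
    by (simp add: p_def)
qed

end

theory Submission
  imports Defs
begin

text \<open>
  Modulo 2 the recurrence \<open>p n (k+1) = p n k + p (n-k-1) (k+1)\<close> makes \<open>p _ k\<close> purely
  periodic by induction on \<open>k\<close>: twice a period of \<open>p _ k\<close>, times \<open>k+1\<close>, is a period of
  \<open>p _ (k+1)\<close>. Hence the density exists. Read backwards, the recurrence shows that a run of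
  \<open>k(k+1)/2\<close> consecutive even values of \<open>p _ k\<close> yields a run of \<open>(k-1)k/2\<close> even values of
  \<open>p _ (k-1)\<close>, and so on down to an even value of \<open>p _ 1\<close>, which is constantly 1. So every
  interval of length \<open>k(k+1)/2\<close> contains an odd value.
\<close>

text \<open>A partition either avoids the part \<open>Suc k\<close> or contains it; deleting one
  copy in the second case is a bijection onto the partitions of \<open>n - Suc k\<close>.\<close>

lemma p_Suc_right:
  "p n (Suc k) = p n k + (if Suc k \<le> n then p (n - Suc k) (Suc k) else 0)"
proof -
  let ?A = "partitions_le n k"
  let ?B = "add_mset (Suc k) ` {M. sum_mset M + Suc k = n \<and> set_mset M \<subseteq> {1..Suc k}}"
  have "partitions_le n (Suc k) = ?A \<union> ?B"
  proof (intro equalityI subsetI)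
    fix M assume M: "M \<in> partitions_le n (Suc k)"
    show "M \<in> ?A \<union> ?B"
    proof (cases "Suc k \<in># M")
      case True
      then obtain M' where "M = add_mset (Suc k) M'"
        by (blast dest: multi_member_split)
      then show ?thesis
        using M by (auto simp: partitions_le_def)
    next
      case False
      then show ?thesis
        using M by (force simp: partitions_le_def le_Suc_eq)
    qed
  next
    fix M assume "M \<in> ?A \<union> ?B"
    then show "M \<in> partitions_le n (Suc k)"
      by (force simp: partitions_le_def)
  qed
  moreover have "?A \<inter> ?B = {}"
    by (auto simp: partitions_le_def)
  moreover have B: "?B = (if Suc k \<le> n then add_mset (Suc k) ` partitions_le (n - Suc k) (Suc k) else {})"
    by (auto simp: partitions_le_def)
  moreover have "card (add_mset (Suc k) ` partitions_le (n - Suc k) (Suc k)) = p (n - Suc k) (Suc k)"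
    by (simp add: p_def card_image inj_on_def)
  moreover have "finite ?B"
    unfolding B by (simp add: finite_partitions_le)
  ultimately show ?thesis
    by (auto simp: p_def card_Un_disjoint finite_partitions_le)
qed

lemma p_add_Suc: "p (n + Suc k) (Suc k) = p (n + Suc k) k + p n (Suc k)"
  using p_Suc_right[of "n + Suc k" k] by simp

lemma p_one_right: "p n 1 = 1"
proof -
  have "partitions_le n 1 = {replicate_mset n 1}"
  proof (intro equalityI subsetI)
    fix M assume M: "M \<in> partitions_le n 1"
    then have "set_mset M \<subseteq> {1}"
      by (auto simp: partitions_le_def)
    then obtain m where "M = replicate_mset m 1"
      by (metis set_mset_subset_singletonD)
    then show "M \<in> {replicate_mset n 1}"
      using M by (simp add: partitions_le_def)
  qed (auto simp: partitions_le_def)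
  then show ?thesis
    by (simp add: p_def)
qed

text \<open>Iterating the recurrence \<open>2 * T\<close> times adds to \<open>b n\<close> a sum of
  \<open>2 * T\<close> values of \<open>a\<close>. A single round of \<open>T\<close> values could
  be odd; two rounds agree termwise modulo 2 and cancel.\<close>

lemma parity_periodic_of_difference:
  fixes a b :: "nat \<Rightarrow> nat"
  assumes b: "\<And>n. b (n + k) = b n + a (n + k)"
    and a: "\<And>n. even (a (n + T)) = even (a n)"
  shows "even (b (n + 2 * T * k)) = even (b n)"
proof -
  have iter: "b (n + j * k) = b n + (\<Sum>i<j. a (n + Suc i * k))" for j
    using b[of "n + _ * k"] by (induction j) (auto simp: algebra_simps)
  have period: "even (a (m + j * T)) = even (a m)" for m j
    using a[of "m + _ * T"] by (induction j) (auto simp: algebra_simps)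
  have split: "(\<Sum>i<m + j. g i) = (\<Sum>i<m. g i) + (\<Sum>i<j. g (m + i))" for g :: "nat \<Rightarrow> nat" and m j
    by (induction j) simp_all
  \<comment> \<open>Term \<open>i\<close> is paired with term \<open>T + i\<close>; their arguments
    differ by \<open>k * T\<close>, a multiple of the period of \<open>a\<close>.\<close>
  have "(\<Sum>i<T + T. a (n + Suc i * k)) = (\<Sum>i<T. a (n + Suc i * k) + a (n + Suc i * k + k * T))"
    unfolding split sum.distrib by (simp add: algebra_simps)
  moreover have "even (\<Sum>i<T. a (n + Suc i * k) + a (n + Suc i * k + k * T))"
    by (rule dvd_sum) (simp only: even_add period)
  ultimately show ?thesis
    using iter[of "2 * T"] by (simp add: mult_2)
qed

lemma p_parity_periodic:
  assumes "k \<ge> 1"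
  shows "\<exists>T>0. \<forall>n. even (p (n + T) k) = even (p n k)"
  using assms
proof (induction k rule: nat_induct_at_least)
  case base
  then show ?case
    by (auto simp: p_one_right simp del: One_nat_def)
next
  case (Suc k)
  then obtain T where T: "T > 0" "\<And>n. even (p (n + T) k) = even (p n k)"
    by blast
  have "even (p (n + 2 * T * Suc k) (Suc k)) = even (p n (Suc k))" for n
    by (rule parity_periodic_of_difference[where a = "\<lambda>n. p n k"])
       (simp_all only: p_add_Suc T add.commute)
  then show ?case
    using T(1) by (intro exI[of _ "2 * T * Suc k"]) simp
qed

lemma odd_p_in_window:
  assumes "k \<ge> 1"
  shows "\<exists>n\<in>{m..<m + (\<Sum>{1..k})}. odd (p n k)"
  using assms
proof (induction k arbitrary: m rule: nat_induct_at_least)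
  case base
  then show ?case
    by (auto simp: p_one_right simp del: One_nat_def)
next
  case (Suc k)
  \<comment> \<open>Skipping the first \<open>Suc k\<close> places of the window leaves exactly the
    length needed for \<open>k\<close>, and keeps \<open>n - Suc k\<close> inside the full
    window.\<close>
  obtain n where n: "n \<in> {m + Suc k..<m + Suc k + \<Sum>{1..k}}" "odd (p n k)"
    using Suc.IH by blast
  define n' where "n' = n - Suc k"
  have n': "n = n' + Suc k"
    using n(1) by (simp add: n'_def)
  have "odd (p n (Suc k)) \<or> odd (p n' (Suc k))"
    using n(2) unfolding n' p_add_Suc by auto
  moreover have "n \<in> {m..<m + \<Sum>{1..Suc k}}" "n' \<in> {m..<m + \<Sum>{1..Suc k}}"
    using n(1) unfolding n' by auto
  ultimately show ?case
    by blast
qed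

text \<open>The counting function differs from a linear function of slope \<open>c T / T\<close> by
  a periodic, hence bounded, error \<open>f\<close>, which vanishes after division by
  \<open>N\<close>.\<close>

lemma periodic_density:
  fixes P :: "nat \<Rightarrow> bool"
  assumes "T > 0" and P: "\<And>n. P (n + T) = P n"
  shows "(\<lambda>N. real (card {n. n \<le> N \<and> P n}) / real N) \<longlonglongrightarrow> real (card {n. n < T \<and> P n}) / real T"
proof -
  define c where "c N = card {n. n < N \<and> P n}" for N
  have c_sum: "c N = (\<Sum>n<N. of_bool (P n))" for N
    by (simp add: c_def Int_def)
  have c_add: "c (N + T) = c N + c T" for N
    by (induction N) (simp_all add: c_sum P)
  define f where "f N = real (c N) - real (c T) / real T * real N" for N
  have f_add: "f (N + T) = f N" for N
    using \<open>T > 0\<close> by (simp add: f_def c_add field_simps)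
  have "f (m + q * T) = f m" for m q
    using f_add[of "m + _ * T"] by (induction q) (auto simp: algebra_simps)
  then have f_mod: "f N = f (N mod T)" for N
    by (metis mod_mult_div_eq mult.commute)
  \<comment> \<open>By periodicity, \<open>norm (f N)\<close> equals one of the summands on the
    right.\<close>
  have "norm (f N) \<le> (\<Sum>i<T. norm (f i))" for N
    unfolding f_mod[of N] using \<open>T > 0\<close> by (intro member_le_sum) auto
  then have "Bseq f"
    by (rule BseqI')
  \<comment> \<open>Counting \<open>n \<le> N\<close> means evaluating \<open>c\<close> at
    \<open>Suc N\<close>; the added constant is the linear term's growth over that extra
    step.\<close>
  then have "Bseq (\<lambda>N. f (Suc N) + real (c T) / real T)"
    by (simp add: Bseq_Suc_iff Bseq_add)
  then have "(\<lambda>N. 1 / real N * (f (Suc N) + real (c T) / real T)) \<longlonglongrightarrow> 0"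
    using bounded_bilinear.Zfun_prod_Bfun[OF bounded_bilinear_mult] lim_1_over_n
    by (simp only: tendsto_Zfun_iff diff_0_right)
  then have "(\<lambda>N. real (c T) / real T + 1 / real N * (f (Suc N) + real (c T) / real T)) \<longlonglongrightarrow> real (c T) / real T + 0"
    by (intro tendsto_add tendsto_const)
  moreover have "\<forall>\<^sub>F N in sequentially. real (c T) / real T + 1 / real N * (f (Suc N) + real (c T) / real T)
      = real (c (Suc N)) / real N"
    using eventually_gt_at_top[of 0]
    by eventually_elim (use \<open>T > 0\<close> in \<open>simp add: f_def field_simps\<close>)
  ultimately have "(\<lambda>N. real (c (Suc N)) / real N) \<longlonglongrightarrow> real (c T) / real T"
    by (simp add: tendsto_cong)
  then show ?thesis
    by (simp add: c_def less_Suc_eq_le)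
qed

text \<open>Each block of \<open>D\<close> numbers removed from the top end costs at least one
  element satisfying \<open>P\<close>; the \<open>+ 1\<close> pays for the incomplete block left at
  the bottom.\<close>

lemma card_ge_of_windows:
  fixes P :: "nat \<Rightarrow> bool"
  assumes "\<And>m. \<exists>n\<in>{m..<m + D}. P n"
  shows "N \<le> D * (card {n. n \<le> N \<and> P n} + 1)"
proof (induction N rule: less_induct)
  case (less N)
  show ?case
  proof (cases "N < D")
    case False
    then obtain n where n: "n \<in> {N - D + 1..<N - D + 1 + D}" "P n"
      using assms by blast
    have "card {n. n \<le> N - D \<and> P n} + 1 = card (insert n {n. n \<le> N - D \<and> P n})"
      using n by (subst card_insert_disjoint) auto
    also have "\<dots> \<le> card {n. n \<le> N \<and> P n}"
      using n False by (intro card_mono) auto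
    finally have "D * (card {n. n \<le> N - D \<and> P n} + 1) \<le> D * card {n. n \<le> N \<and> P n}"
      by (rule mult_left_mono) simp
    moreover have "D > 0"
      using assms[of 0] by (cases D) auto
    then have "N - D \<le> D * (card {n. n \<le> N - D \<and> P n} + 1)"
      using False by (intro less.IH) auto
    ultimately show ?thesis
      using False by simp
  qed simp
qed

theorem theorem1p3:
  fixes k :: nat
  assumes "k \<ge> 1"
  shows "\<exists>L::real.
    (\<lambda>N::nat. real (card {n::nat. 0 \<le> n \<and> n \<le> N \<and> odd (p n k)}) / real N) \<longlonglongrightarrow> L \<and>
    L \<ge> 2 / (real k * (real k + 1))"
proof -
  define C where "C N = real (card {n. n \<le> N \<and> odd (p n k)})" for N
  obtain T where "T > 0" "\<And>n. even (p (n + T) k) = even (p n k)"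
    using p_parity_periodic[OF assms] by blast
  then obtain L where L: "(\<lambda>N. C N / real N) \<longlonglongrightarrow> L"
    using periodic_density[of T "\<lambda>n. odd (p n k)"] by (auto simp: C_def)
  define D where "D = real (\<Sum>{1..k})"
  have D: "2 * D = real k * (real k + 1)"
    unfolding D_def by (induction k) (simp_all add: algebra_simps)
  then have "D > 0"
    using assms by (metis add_pos_pos mult_pos_pos of_nat_0_less_iff zero_less_mult_pos zero_less_numeral zero_less_one less_le_trans)
  have D_bound: "real N \<le> D * (C N + 1)" for N
    using card_ge_of_windows[OF odd_p_in_window[OF assms], of N]
    unfolding C_def D_def by (metis of_nat_1 of_nat_add of_nat_le_iff of_nat_mult)
  \<comment> \<open>The \<open>+ 1\<close> in \<open>D_bound\<close> becomes the error
    \<open>1 / real N\<close>, which disappears in the limit.\<close>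
  have "1 / D - 1 / real N \<le> C N / real N" if "N > 0" for N
  proof -
    have "1 / D \<le> (C N + 1) / real N"
      using D_bound[of N] \<open>D > 0\<close> that by (simp add: field_simps)
    then show ?thesis
      by (simp add: add_divide_distrib)
  qed
  then have "1 / D - 0 \<le> L"
    by (intro LIMSEQ_le[OF tendsto_diff[OF tendsto_const lim_1_over_n] L] exI[of _ 1]) auto
  moreover have "1 / D = 2 / (real k * (real k + 1))"
    using \<open>D > 0\<close> by (simp flip: D)
  ultimately show ?thesis
    using L by (auto simp: C_def)
qed

end
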